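(* If $\rho_{AB}$ is supported on the symmetric subspace or on the antisymmetric subspace of $\mathcal H_A\otimes\mathcal H_B$ (with $\mathcal H_A\cong\mathcal H_B$), then $\Upsilon(A:B)=0$. In particular, $\Upsilon(A:B)=0$ for every pure state $\rho_{AB}=\ket\phi\bra\phi_{AB}$.
   Context: Let $\rho_{AB}$ be a finite-dimensional bipartite state shared by Alice ($A$) and Bob ($B$), with $A$ and $B$ of the same dimension so that they can be swapped. Let $\ket{\psi}_{ABR}$ be a purification, i.e. ${\rm Tr}_R\ket\psi\bra\psi_{ABR}=\rho_{AB}$, where $R$ is an inaccessible reference system. Let $\psi_{BAR}$ denote the state obtained from $\psi_{ABR}$ by applying the swap of $A$ and $B$. A state exchange protocol on $n$ copies is an LOCC operation between Alice and Bob, acting on $\psi_{ABR}^{\otimes n}$ (with $R$ untouched) together with a supply of maximally entangled qubit pairs (ebits) shared between Alice and Bob, producing a state $\rho^{ex}_{ABR}$. It is faithful if $F(\rho^{ex}_{ABR},\psi_{BAR}^{\otimes n})\to1$ as $n\to\infty$, where $F(\rho,\sigma)={\rm Tr}\sqrt{\sqrt\sigma\rho\sqrt\sigma}$. The uncommon information $\Upsilon(A:B)$ is the infimum of rates $r$ (ebits consumed per copy, asymptotically) for which faithful state exchange protocols exist, classical communication being free. For a pure state $\ket\phi_{AB}$, the symmetric/antisymmetric subspace is taken with respect to a suitable local identification of $\mathcal H_A$ and $\mathcal H_B$ (e.g. via the Schmidt bases). *)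

theory Defs
  imports "HOL-Analysis.Analysis"
begin

(* A vector on a system with (finite) basis C is a function  'i => complex  vanishing
   outside C; an operator is a matrix  'i => 'i => complex  vanishing outside C x C. *)

definition is_vec :: "'i set \<Rightarrow> ('i \<Rightarrow> complex) \<Rightarrow> bool" where
  "is_vec C v \<longleftrightarrow> (\<forall>x. x \<notin> C \<longrightarrow> v x = 0)"

definition is_op :: "'i set \<Rightarrow> ('i \<Rightarrow> 'i \<Rightarrow> complex) \<Rightarrow> bool" where
  "is_op C A \<longleftrightarrow> (\<forall>x y. x \<notin> C \<or> y \<notin> C \<longrightarrow> A x y = 0)"

definition op_mult :: "'i set \<Rightarrow> ('i \<Rightarrow> 'i \<Rightarrow> complex) \<Rightarrow> ('i \<Rightarrow> 'i \<Rightarrow> complex) \<Rightarrow> ('i \<Rightarrow> 'i \<Rightarrow> complex)" where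
  "op_mult C A B = (\<lambda>x y. \<Sum>z\<in>C. A x z * B z y)"

definition op_apply :: "'i set \<Rightarrow> ('i \<Rightarrow> 'i \<Rightarrow> complex) \<Rightarrow> ('i \<Rightarrow> complex) \<Rightarrow> ('i \<Rightarrow> complex)" where
  "op_apply C A v = (\<lambda>x. \<Sum>y\<in>C. A x y * v y)"

definition op_trace :: "'i set \<Rightarrow> ('i \<Rightarrow> 'i \<Rightarrow> complex) \<Rightarrow> complex" where
  "op_trace C A = (\<Sum>x\<in>C. A x x)"

definition adj :: "('i \<Rightarrow> 'i \<Rightarrow> complex) \<Rightarrow> ('i \<Rightarrow> 'i \<Rightarrow> complex)" where
  "adj A = (\<lambda>x y. cnj (A y x))"

definition id_op :: "'i set \<Rightarrow> ('i \<Rightarrow> 'i \<Rightarrow> complex)" where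
  "id_op C = (\<lambda>x y. if x \<in> C \<and> x = y then 1 else 0)"

definition qform :: "'i set \<Rightarrow> ('i \<Rightarrow> 'i \<Rightarrow> complex) \<Rightarrow> ('i \<Rightarrow> complex) \<Rightarrow> complex" where
  "qform C A v = (\<Sum>x\<in>C. \<Sum>y\<in>C. cnj (v x) * A x y * v y)"

text \<open>Positive semidefinite operator on carrier C (over the complex numbers this implies Hermitian).\<close>
definition psd :: "'i set \<Rightarrow> ('i \<Rightarrow> 'i \<Rightarrow> complex) \<Rightarrow> bool" where
  "psd C A \<longleftrightarrow> is_op C A \<and> (\<forall>v. qform C A v \<in> \<real> \<and> 0 \<le> Re (qform C A v))"

definition density_op :: "'i set \<Rightarrow> ('i \<Rightarrow> 'i \<Rightarrow> complex) \<Rightarrow> bool" where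
  "density_op C \<rho> \<longleftrightarrow> psd C \<rho> \<and> op_trace C \<rho> = 1"

definition unit_vec :: "'i set \<Rightarrow> ('i \<Rightarrow> complex) \<Rightarrow> bool" where
  "unit_vec C v \<longleftrightarrow> is_vec C v \<and> (\<Sum>x\<in>C. (cmod (v x))\<^sup>2) = 1"

definition outer :: "('i \<Rightarrow> complex) \<Rightarrow> ('i \<Rightarrow> 'i \<Rightarrow> complex)" where
  "outer v = (\<lambda>x y. v x * cnj (v y))"

definition unitary_op :: "'i set \<Rightarrow> ('i \<Rightarrow> 'i \<Rightarrow> complex) \<Rightarrow> bool" where
  "unitary_op C U \<longleftrightarrow> is_op C U \<and> op_mult C (adj U) U = id_op C \<and> op_mult C U (adj U) = id_op C"

definition op_sqrt :: "'i set \<Rightarrow> ('i \<Rightarrow> 'i \<Rightarrow> complex) \<Rightarrow> ('i \<Rightarrow> 'i \<Rightarrow> complex)" where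
  "op_sqrt C A = (THE S. psd C S \<and> op_mult C S S = A)"

definition fidelity :: "'i set \<Rightarrow> ('i \<Rightarrow> 'i \<Rightarrow> complex) \<Rightarrow> ('i \<Rightarrow> 'i \<Rightarrow> complex) \<Rightarrow> real" where
  "fidelity C \<rho> \<sigma> =
     Re (op_trace C (op_sqrt C (op_mult C (op_mult C (op_sqrt C \<sigma>) \<rho>) (op_sqrt C \<sigma>))))"

definition supported_on :: "'i set \<Rightarrow> ('i \<Rightarrow> 'i \<Rightarrow> complex) \<Rightarrow> (('i \<Rightarrow> complex) \<Rightarrow> bool) \<Rightarrow> bool" where
  "supported_on C \<rho> P \<longleftrightarrow> (\<forall>v. is_vec C v \<longrightarrow> P (op_apply C \<rho> v))"

definition AB :: "nat \<Rightarrow> (nat \<times> nat) set" where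
  "AB d = {0..<d} \<times> {0..<d}"

definition ABR :: "nat \<Rightarrow> nat \<Rightarrow> (nat \<times> nat \<times> nat) set" where
  "ABR d dR = {0..<d} \<times> {0..<d} \<times> {0..<dR}"

text \<open>Swap of A and B relative to the identification  W : H_A -> H_B  (a unitary d x d matrix,
  W y a = <y|W|a>):  S_W |a>|b> = W^dagger|b> (x) W|a>.  For W = identity this is the usual swap.\<close>
definition swap_op :: "nat \<Rightarrow> (nat \<Rightarrow> nat \<Rightarrow> complex) \<Rightarrow> (nat \<times> nat) \<Rightarrow> (nat \<times> nat) \<Rightarrow> complex" where
  "swap_op d W = (\<lambda>(x, y) (a, b).
      if (x, y) \<in> AB d \<and> (a, b) \<in> AB d then cnj (W b x) * W y a else 0)"

definition symmetric_sub :: "nat \<Rightarrow> (nat \<Rightarrow> nat \<Rightarrow> complex) \<Rightarrow> ((nat \<times> nat) \<Rightarrow> complex) \<Rightarrow> bool" where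
  "symmetric_sub d W v \<longleftrightarrow> op_apply (AB d) (swap_op d W) v = v"

definition antisymmetric_sub :: "nat \<Rightarrow> (nat \<Rightarrow> nat \<Rightarrow> complex) \<Rightarrow> ((nat \<times> nat) \<Rightarrow> complex) \<Rightarrow> bool" where
  "antisymmetric_sub d W v \<longleftrightarrow> op_apply (AB d) (swap_op d W) v = (\<lambda>x. - v x)"

definition ptrace_R :: "nat \<Rightarrow> (nat \<times> nat \<times> nat \<Rightarrow> complex) \<Rightarrow> (nat \<times> nat) \<Rightarrow> (nat \<times> nat) \<Rightarrow> complex" where
  "ptrace_R dR \<psi> = (\<lambda>(a, b) (a', b'). \<Sum>r<dR. \<psi> (a, b, r) * cnj (\<psi> (a', b', r)))"

definition purification :: "nat \<Rightarrow> nat \<Rightarrow> ((nat \<times> nat) \<Rightarrow> (nat \<times> nat) \<Rightarrow> complex) \<Rightarrow> (nat \<times> nat \<times> nat \<Rightarrow> complex) \<Rightarrow> bool" where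
  "purification d dR \<rho> \<psi> \<longleftrightarrow> unit_vec (ABR d dR) \<psi> \<and> ptrace_R dR \<psi> = \<rho>"

definition swapped_pure :: "nat \<Rightarrow> (nat \<Rightarrow> nat \<Rightarrow> complex) \<Rightarrow> (nat \<times> nat \<times> nat \<Rightarrow> complex) \<Rightarrow> (nat \<times> nat \<times> nat \<Rightarrow> complex)" where
  "swapped_pure d W \<psi> = (\<lambda>(x, y, r). \<Sum>a<d. \<Sum>b<d. swap_op d W (x, y) (a, b) * \<psi> (a, b, r))"

type_synonym ('a, 'b, 'r) gop = "('a \<times> 'b \<times> 'r) \<Rightarrow> ('a \<times> 'b \<times> 'r) \<Rightarrow> complex"

text \<open>Local CP map on Alice (Kraus list Ks, each K : X -> X') tensored with identity on Bob and R.\<close>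
definition apply_A :: "'a set \<Rightarrow> ('a \<Rightarrow> 'a \<Rightarrow> complex) list \<Rightarrow> ('a, 'b, 'r) gop \<Rightarrow> ('a, 'b, 'r) gop" where
  "apply_A X Ks \<rho> = (\<lambda>(x, y, r) (x', y', r').
     (\<Sum>K\<leftarrow>Ks. \<Sum>x1\<in>X. \<Sum>x2\<in>X. K x x1 * \<rho> (x1, y, r) (x2, y', r') * cnj (K x' x2)))"

definition apply_B :: "'b set \<Rightarrow> ('b \<Rightarrow> 'b \<Rightarrow> complex) list \<Rightarrow> ('a, 'b, 'r) gop \<Rightarrow> ('a, 'b, 'r) gop" where
  "apply_B Y Ks \<rho> = (\<lambda>(x, y, r) (x', y', r').
     (\<Sum>K\<leftarrow>Ks. \<Sum>y1\<in>Y. \<Sum>y2\<in>Y. K y y1 * \<rho> (x, y1, r) (x', y2, r') * cnj (K y' y2)))"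

text \<open>A quantum instrument from carrier X to carrier X': a finite list of CP maps (each a Kraus list)
  whose sum is trace preserving.\<close>
definition instrument :: "'a set \<Rightarrow> 'a set \<Rightarrow> ('a \<Rightarrow> 'a \<Rightarrow> complex) list list \<Rightarrow> bool" where
  "instrument X X' Iss \<longleftrightarrow> finite X' \<and>
     (\<forall>Ks\<in>set Iss. \<forall>K\<in>set Ks. \<forall>x x1. x \<notin> X' \<or> x1 \<notin> X \<longrightarrow> K x x1 = 0) \<and>
     (\<forall>x1\<in>X. \<forall>x2\<in>X.
        (\<Sum>Ks\<leftarrow>Iss. \<Sum>K\<leftarrow>Ks. \<Sum>x\<in>X'. cnj (K x x1) * K x x2) = (if x1 = x2 then 1 else 0))"

text \<open>locc X Y X' Y' Phi: Phi is a finite-round LOCC channel from Alice's system X and Bob's system Y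
  to Alice's X' and Bob's Y', acting trivially on the reference R.  A round: one party applies a local
  instrument, broadcasts the outcome j, and the rest of the protocol may depend on j.\<close>
inductive locc :: "'a set \<Rightarrow> 'b set \<Rightarrow> 'a set \<Rightarrow> 'b set \<Rightarrow> (('a, 'b, 'r) gop \<Rightarrow> ('a, 'b, 'r) gop) \<Rightarrow> bool" where
  locc_id: "finite X \<Longrightarrow> finite Y \<Longrightarrow> locc X Y X Y (\<lambda>\<rho>. \<rho>)"
| locc_alice: "finite X \<Longrightarrow> instrument X X'' Iss \<Longrightarrow> (\<forall>j<length Iss. locc X'' Y X' Y' (\<Phi>s j)) \<Longrightarrow>
     locc X Y X' Y' (\<lambda>\<rho> u w. \<Sum>j<length Iss. \<Phi>s j (apply_A X (Iss ! j) \<rho>) u w)"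
| locc_bob: "finite Y \<Longrightarrow> instrument Y Y'' Iss \<Longrightarrow> (\<forall>j<length Iss. locc X Y'' X' Y' (\<Phi>s j)) \<Longrightarrow>
     locc X Y X' Y' (\<lambda>\<rho> u w. \<Sum>j<length Iss. \<Phi>s j (apply_B Y (Iss ! j) \<rho>) u w)"

definition lists_of :: "nat \<Rightarrow> nat \<Rightarrow> nat list set" where
  "lists_of n m = {xs. length xs = n \<and> (\<forall>i<n. xs ! i < m)}"

text \<open>Alice's (resp. Bob's) input system: n copies of C^d followed by her halves of k ebits.\<close>
definition party_in :: "nat \<Rightarrow> nat \<Rightarrow> nat \<Rightarrow> nat list set" where
  "party_in d n k = {xs. length xs = n + k \<and> (\<forall>i<n. xs ! i < d) \<and> (\<forall>i. n \<le> i \<and> i < n + k \<longrightarrow> xs ! i < 2)}"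

text \<open>psi_ABR^{(x) n} (x) Phi^{(x) k}, Phi = (|00>+|11>)/sqrt 2 shared between Alice and Bob.\<close>
definition input_vec :: "nat \<Rightarrow> nat \<Rightarrow> (nat \<times> nat \<times> nat \<Rightarrow> complex) \<Rightarrow> nat \<Rightarrow> nat \<Rightarrow> (nat list \<times> nat list \<times> nat list \<Rightarrow> complex)" where
  "input_vec d dR \<psi> n k = (\<lambda>(xs, ys, rs).
     if xs \<in> party_in d n k \<and> ys \<in> party_in d n k \<and> rs \<in> lists_of n dR
     then (\<Prod>i<n. \<psi> (xs ! i, ys ! i, rs ! i)) *
          (\<Prod>i\<in>{n..<n+k}. if xs ! i = ys ! i then complex_of_real (1 / sqrt 2) else 0)
     else 0)"

definition target_vec :: "nat \<Rightarrow> nat \<Rightarrow> (nat \<Rightarrow> nat \<Rightarrow> complex) \<Rightarrow> (nat \<times> nat \<times> nat \<Rightarrow> complex) \<Rightarrow> nat \<Rightarrow> (nat list \<times> nat list \<times> nat list \<Rightarrow> complex)" where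
  "target_vec d dR W \<psi> n = (\<lambda>(xs, ys, rs).
     if xs \<in> lists_of n d \<and> ys \<in> lists_of n d \<and> rs \<in> lists_of n dR
     then (\<Prod>i<n. swapped_pure d W \<psi> (xs ! i, ys ! i, rs ! i))
     else 0)"

definition out_carrier :: "nat \<Rightarrow> nat \<Rightarrow> nat \<Rightarrow> (nat list \<times> nat list \<times> nat list) set" where
  "out_carrier d dR n = lists_of n d \<times> lists_of n d \<times> lists_of n dR"

definition achievable_rate :: "nat \<Rightarrow> nat \<Rightarrow> (nat \<Rightarrow> nat \<Rightarrow> complex) \<Rightarrow> (nat \<times> nat \<times> nat \<Rightarrow> complex) \<Rightarrow> real \<Rightarrow> bool" where
  "achievable_rate d dR W \<psi> r \<longleftrightarrow>
     (\<exists>(k :: nat \<Rightarrow> nat) (\<Lambda> :: nat \<Rightarrow> (nat list, nat list, nat list) gop \<Rightarrow> (nat list, nat list, nat list) gop).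
        (\<forall>n. locc (party_in d n (k n)) (party_in d n (k n)) (lists_of n d) (lists_of n d) (\<Lambda> n)) \<and>
        limsup (\<lambda>n. ereal (real (k n) / real n)) \<le> ereal r \<and>
        (\<lambda>n. fidelity (out_carrier d dR n) (\<Lambda> n (outer (input_vec d dR \<psi> n (k n))))
                      (outer (target_vec d dR W \<psi> n))) \<longlonglongrightarrow> 1)"

definition uncommon_info :: "nat \<Rightarrow> nat \<Rightarrow> (nat \<Rightarrow> nat \<Rightarrow> complex) \<Rightarrow> (nat \<times> nat \<times> nat \<Rightarrow> complex) \<Rightarrow> real" where
  "uncommon_info d dR W \<psi> = Inf {r. achievable_rate d dR W \<psi> r}"

end

theory Submission
  imports Defs Jordan_Normal_Form.Schur_Decomposition "HOL-Computational_Algebra.Fundamental_Theorem_Algebra"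
begin

(* If rho is supported on the eigenspace of the swap S_W for the eigenvalue s = 1 or s = -1, then
   (S_W - s) rho = 0.  The component (S_W (x) 1_R - s) psi of a purification has squared norm
   Tr ((S_W - s) rho (S_W - s)^dagger) = 0, so (S_W (x) 1_R) psi = s psi and the target of the
   exchange is psi_BAR^(x)n = s^n psi_ABR^(x)n.  Doing nothing, with no ebits, is therefore an
   exchange of fidelity exactly 1, and since rates are nonnegative the uncommon information is 0.

   For a pure state phi with coefficient matrix Phi, S_W acts as Phi |-> W^dagger (W Phi)^T, so phi
   is symmetric as soon as W Phi is a symmetric matrix.  Every square complex matrix admits such a
   unitary W (if Phi = U Sigma V^dagger, take W = conj(V) U^dagger); it is built by induction on the
   size, splitting off one singular pair A q = sigma u, A^dagger u = tau q at a time. *)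

no_notation Finite_Cartesian_Product.vec.vec_nth (infixl \<open>$\<close> 90)
hide_const (open) Matrix.unit_vec

section \<open>Operators on finite carriers\<close>

lemma op_mult_assoc:
  assumes "finite C"
  shows "op_mult C (op_mult C A B) D = op_mult C A (op_mult C B D)"
  unfolding op_mult_def
  by (intro ext) (simp add: sum_distrib_left sum_distrib_right mult.assoc, rule sum.swap)

lemma op_apply_op_mult: "op_apply C (op_mult C A B) v = op_apply C A (op_apply C B v)"
  unfolding op_mult_def op_apply_def
  by (intro ext) (simp add: sum_distrib_left sum_distrib_right mult.assoc, rule sum.swap)

lemma op_apply_outer: "op_apply C (outer v) w = (\<lambda>x. v x * (\<Sum>y\<in>C. cnj (v y) * w y))"
  unfolding op_apply_def outer_def by (simp add: sum_distrib_left mult.assoc)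

lemma sum_mult_basis_vec:
  assumes "finite C" "y \<in> C"
  shows "(\<Sum>z\<in>C. f z * (if z = y then 1 else 0)) = (f y :: 'a :: semiring_1)"
  using assms by (simp add: if_distrib[of "(*) _"] cong: if_cong)

lemma op_apply_basis_vec:
  assumes "finite C" "y \<in> C"
  shows "op_apply C A (\<lambda>z. if z = y then 1 else 0) = (\<lambda>x. A x y)"
  unfolding op_apply_def by (intro ext) (rule sum_mult_basis_vec[OF assms])

lemma op_apply_scale: "op_apply C A (\<lambda>x. c * v x) = (\<lambda>x. c * op_apply C A v x)"
  unfolding op_apply_def by (simp add: sum_distrib_left algebra_simps)

lemma qform_eq_sum_op_apply: "qform C S v = (\<Sum>x\<in>C. cnj (v x) * op_apply C S v x)"
  unfolding qform_def op_apply_def by (simp add: sum_distrib_left mult.assoc)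

lemma unit_vec_sum_cnj:
  assumes "unit_vec C v"
  shows "(\<Sum>x\<in>C. cnj (v x) * v x) = 1"
proof -
  have "(\<Sum>x\<in>C. complex_of_real ((cmod (v x))\<^sup>2)) = 1"
    using assms unfolding Defs.unit_vec_def by (metis of_real_1 of_real_sum)
  then show ?thesis by (simp only: complex_norm_square mult.commute)
qed

text \<open>If \<open>S (S w) = 0\<close>, the real quadratic \<open>t \<mapsto> qform C S (w + t S w) = qform C S w + t |S w|\<^sup>2\<close>
  is nonnegative, which forces \<open>|S w|\<^sup>2 = 0\<close>.\<close>
lemma psd_apply_eq_0:
  assumes fin: "finite C" and S: "psd C S"
    and SSw: "\<forall>x\<in>C. op_apply C S (op_apply C S w) x = 0"
  shows "\<forall>x\<in>C. op_apply C S w x = 0"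
proof -
  define u where "u = op_apply C S w"
  define N where "N = (\<Sum>x\<in>C. (cmod (u x))\<^sup>2)"
  have qform_line: "qform C S (\<lambda>x. w x + of_real t * u x) = qform C S w + of_real (t * N)" for t
  proof -
    have "op_apply C S (\<lambda>x. w x + of_real t * u x) = (\<lambda>x. u x + of_real t * op_apply C S u x)"
      unfolding u_def op_apply_def by (simp add: algebra_simps sum.distrib sum_distrib_left)
    then have "qform C S (\<lambda>x. w x + of_real t * u x) = (\<Sum>x\<in>C. (cnj (w x) + of_real t * cnj (u x)) * u x)"
      unfolding qform_eq_sum_op_apply using SSw u_def by (intro sum.cong) auto
    also have "\<dots> = (\<Sum>x\<in>C. cnj (w x) * u x) + of_real t * (\<Sum>x\<in>C. u x * cnj (u x))"
      by (simp add: algebra_simps sum.distrib sum_distrib_left)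
    also have "(\<Sum>x\<in>C. u x * cnj (u x)) = of_real N"
      unfolding N_def by (simp only: of_real_sum complex_norm_square)
    also have "(\<Sum>x\<in>C. cnj (w x) * u x) = qform C S w"
      unfolding qform_eq_sum_op_apply u_def ..
    finally show ?thesis by simp
  qed
  have nonneg: "0 \<le> Re (qform C S w) + t * N" for t
    using S qform_line[of t] unfolding psd_def by (metis plus_complex.sel(1) Re_complex_of_real)
  have "N \<le> 0"
  proof (rule ccontr)
    assume "\<not> N \<le> 0"
    then show False
      using nonneg[of "- (\<bar>Re (qform C S w)\<bar> + 1) / N"] by simp
  qed
  then have "\<forall>x\<in>C. (cmod (u x))\<^sup>2 = 0"
    using sum_nonneg_eq_0_iff[OF fin, of "\<lambda>x. (cmod (u x))\<^sup>2"] unfolding N_def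
    by (simp add: order_antisym sum_nonneg)
  then show ?thesis unfolding u_def by simp
qed

lemma psd_outer:
  assumes "is_vec C v"
  shows "psd C (outer v)"
proof -
  have "qform C (outer v) u = of_real ((cmod (\<Sum>x\<in>C. cnj (u x) * v x))\<^sup>2)" for u
    unfolding qform_def outer_def complex_norm_square
    by (simp add: sum_distrib_left sum_distrib_right algebra_simps)
  then show ?thesis
    using assms unfolding psd_def is_op_def is_vec_def outer_def by auto
qed

lemma outer_idem:
  assumes "unit_vec C v"
  shows "op_mult C (outer v) (outer v) = outer v"
proof -
  have "(\<Sum>z\<in>C. v x * cnj (v z) * (v z * cnj (v y))) = v x * cnj (v y) * (\<Sum>z\<in>C. cnj (v z) * v z)" for x y
    by (simp add: sum_distrib_left algebra_simps)
  then show ?thesis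
    using unit_vec_sum_cnj[OF assms] unfolding op_mult_def outer_def by (intro ext) simp
qed

text \<open>Since \<open>op_sqrt\<close> is a definite description, the fidelity of a pure state with itself
  needs uniqueness of the square root of the projector \<open>P = outer v\<close>. A square root \<open>S\<close> commutes
  with \<open>P = S S\<close>, so \<open>S v\<close> is a multiple \<open>l v\<close>; then \<open>l\<^sup>2 = 1\<close> and positivity gives \<open>l = 1\<close>.\<close>
lemma psd_square_eq_outer_fixes:
  assumes fin: "finite C" and v: "unit_vec C v"
    and S: "psd C S" and SS: "op_mult C S S = outer v"
  shows "op_apply C S v = v"
proof -
  have nv: "(\<Sum>x\<in>C. cnj (v x) * v x) = 1" by (rule unit_vec_sum_cnj[OF v])
  have Pv: "op_apply C (outer v) v = v"
    unfolding op_apply_outer nv by simp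
  define l where "l = qform C S v"
  have "op_mult C S (outer v) = op_mult C (outer v) S"
    using op_mult_assoc[OF fin, of S S S] unfolding SS by simp
  then have "op_apply C S (op_apply C (outer v) v) = op_apply C (outer v) (op_apply C S v)"
    by (simp flip: op_apply_op_mult)
  then have "op_apply C S v = op_apply C (outer v) (op_apply C S v)"
    unfolding Pv .
  then have Sv: "op_apply C S v = (\<lambda>x. l * v x)"
    unfolding op_apply_outer l_def qform_eq_sum_op_apply by (simp add: mult.commute)
  have "v = op_apply C S (op_apply C S v)"
    using Pv unfolding SS[symmetric] op_apply_op_mult by simp
  also have "\<dots> = (\<lambda>x. l * l * v x)"
    unfolding Sv op_apply_scale by (simp add: Sv mult.assoc)
  finally have vll: "v = (\<lambda>x. l * l * v x)" .
  obtain x0 where "v x0 \<noteq> 0"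
    using nv by (metis (no_types, lifting) mult_zero_right sum.neutral zero_neq_one)
  moreover have "v x0 = l * l * v x0"
    using fun_cong[OF vll] .
  ultimately have "l * l = 1" by simp
  moreover obtain r where r: "l = of_real r" "0 \<le> r"
  proof -
    have "l \<in> \<real>" "0 \<le> Re l" using S unfolding psd_def l_def by auto
    then show thesis using that by (auto elim: Reals_cases)
  qed
  ultimately have "r = 1"
    by (simp flip: of_real_mult add: square_eq_1_iff)
  then show ?thesis using Sv r by simp
qed

text \<open>On the orthogonal complement of \<open>v\<close> we have \<open>S (S w) = P w = 0\<close>, hence \<open>S w = 0\<close>.\<close>
lemma psd_square_eq_outer:
  assumes fin: "finite C" and v: "unit_vec C v"
    and S: "psd C S" and SS: "op_mult C S S = outer v"
  shows "S = outer v"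
proof (intro ext)
  fix x y
  show "S x y = outer v x y"
  proof (cases "x \<in> C \<and> y \<in> C")
    case False
    have "is_op C S" "is_vec C v" using S v unfolding psd_def Defs.unit_vec_def by simp_all
    then show ?thesis using False unfolding is_op_def is_vec_def outer_def by auto
  next
    case True
    define e where "e = (\<lambda>z. if z = y then (1 :: complex) else 0)"
    define w where "w = (\<lambda>z. e z - cnj (v y) * v z)"
    have Sw: "op_apply C S w = (\<lambda>x. S x y - cnj (v y) * v x)"
    proof -
      have "op_apply C S w = (\<lambda>x. op_apply C S e x - cnj (v y) * op_apply C S v x)"
        unfolding w_def op_apply_def by (simp add: right_diff_distrib sum_subtractf sum_distrib_left mult.left_commute)
      then show ?thesis
        using op_apply_basis_vec[OF fin, of y S] psd_square_eq_outer_fixes[OF assms] True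
        unfolding e_def by simp
    qed
    have "op_apply C (outer v) w = (\<lambda>_. 0)"
    proof -
      have "(\<Sum>z\<in>C. cnj (v z) * w z) = (\<Sum>z\<in>C. cnj (v z) * e z) - cnj (v y) * (\<Sum>z\<in>C. cnj (v z) * v z)"
        unfolding w_def by (simp add: right_diff_distrib sum_subtractf sum_distrib_left mult.left_commute)
      also have "\<dots> = 0"
        using sum_mult_basis_vec[OF fin, of y] True unit_vec_sum_cnj[OF v] unfolding e_def by simp
      finally show ?thesis unfolding op_apply_outer by simp
    qed
    then have "\<forall>x\<in>C. op_apply C S (op_apply C S w) x = 0"
      unfolding SS[symmetric] op_apply_op_mult by simp
    from psd_apply_eq_0[OF fin S this] True show ?thesis
      unfolding Sw outer_def by simp
  qed
qed

lemma op_sqrt_outer: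
  assumes "finite C" "unit_vec C v"
  shows "op_sqrt C (outer v) = outer v"
  unfolding op_sqrt_def
proof (rule the_equality)
  show "psd C (outer v) \<and> op_mult C (outer v) (outer v) = outer v"
    using psd_outer[of C v] outer_idem[OF assms(2)] assms(2) unfolding Defs.unit_vec_def by simp
next
  fix S assume "psd C S \<and> op_mult C S S = outer v"
  then show "S = outer v" by (simp add: psd_square_eq_outer[OF assms])
qed

lemma fidelity_outer_self:
  assumes "finite C" "unit_vec C v"
  shows "fidelity C (outer v) (outer v) = 1"
  unfolding fidelity_def op_sqrt_outer[OF assms] outer_idem[OF assms(2)]
  using unit_vec_sum_cnj[OF assms(2)] unfolding op_trace_def outer_def by (simp add: mult.commute)

section \<open>Purifications of states with symmetric support\<close>

lemma supported_on_column:
  assumes "finite C" "supported_on C \<rho> P" "q \<in> C"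
  shows "P (\<lambda>p. \<rho> p q)"
  using assms op_apply_basis_vec[OF assms(1,3), of \<rho>]
  unfolding supported_on_def is_vec_def by (metis (mono_tags, lifting))

text \<open>With \<open>\<rho> = Tr\<^sub>R |\<psi>\<rangle>\<langle>\<psi>|\<close> and \<open>E r = \<Sum>\<^sub>q D q \<psi> q r\<close>, the norm \<open>\<Sum>\<^sub>r |E r|\<^sup>2\<close> equals
  \<open>\<Sum>\<^sub>q\<^sub>' cnj (D q') (\<Sum>\<^sub>q D q \<rho> q q')\<close>.\<close>
lemma reduced_state_kernel:
  fixes \<psi> :: "'q \<Rightarrow> 'r \<Rightarrow> complex"
  assumes "finite C" "finite R" "r \<in> R"
    and D\<rho>: "\<forall>q'\<in>C. (\<Sum>q\<in>C. D q * (\<Sum>r\<in>R. \<psi> q r * cnj (\<psi> q' r))) = 0"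
  shows "(\<Sum>q\<in>C. D q * \<psi> q r) = 0"
proof -
  define E where "E r = (\<Sum>q\<in>C. D q * \<psi> q r)" for r
  have "(\<Sum>r\<in>R. E r * cnj (E r)) = (\<Sum>q'\<in>C. cnj (D q') * (\<Sum>q\<in>C. D q * (\<Sum>r\<in>R. \<psi> q r * cnj (\<psi> q' r))))"
    unfolding E_def
    by (simp add: sum_distrib_left sum_distrib_right algebra_simps sum.swap[of _ R C] sum.swap[of _ R])
  also have "\<dots> = 0" using D\<rho> by simp
  finally have "(\<Sum>r\<in>R. complex_of_real ((cmod (E r))\<^sup>2)) = 0"
    unfolding complex_norm_square .
  then have "(\<Sum>r\<in>R. (cmod (E r))\<^sup>2) = 0"
    by (metis of_real_eq_0_iff of_real_sum)
  then show ?thesis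
    using assms(2,3) sum_nonneg_eq_0_iff[of R "\<lambda>r. (cmod (E r))\<^sup>2"] unfolding E_def by simp
qed

lemma swapped_pure_eigen:
  assumes pur: "purification d dR \<rho> \<psi>"
    and sup: "supported_on (AB d) \<rho> (\<lambda>v. op_apply (AB d) (swap_op d W) v = (\<lambda>x. s * v x))"
  shows "swapped_pure d W \<psi> = (\<lambda>p. s * \<psi> p)"
proof (intro ext, clarify)
  let ?C = "AB d"
  fix x y r
  have fin: "finite ?C" unfolding AB_def by simp
  have \<psi>0: "\<psi> (a, b, r) = 0" if "\<not> ((a, b) \<in> ?C \<and> r < dR)" for a b r
    using pur that unfolding purification_def Defs.unit_vec_def is_vec_def ABR_def AB_def by auto
  have swapped: "swapped_pure d W \<psi> (x, y, r) = (\<Sum>q\<in>?C. swap_op d W (x, y) q * \<psi> (fst q, snd q, r))"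
    unfolding swapped_pure_def AB_def
    by (simp add: sum.cartesian_product atLeast0LessThan case_prod_unfold)
  show "swapped_pure d W \<psi> (x, y, r) = s * \<psi> (x, y, r)"
  proof (cases "(x, y) \<in> ?C \<and> r < dR")
    case True
    define D where "D q = swap_op d W (x, y) q - (if q = (x, y) then s else 0)" for q
    have D_sum: "(\<Sum>q\<in>?C. D q * f q) = (\<Sum>q\<in>?C. swap_op d W (x, y) q * f q) - s * f (x, y)" for f
      using fin True
      unfolding D_def by (simp add: left_diff_distrib sum_subtractf if_distrib[of "\<lambda>c. c * _"] cong: if_cong)
    have "(\<Sum>q\<in>?C. D q * \<psi> (fst q, snd q, r)) = 0"
    proof (rule reduced_state_kernel[OF fin _ _, of "{..<dR}"])
      show "\<forall>q'\<in>?C. (\<Sum>q\<in>?C. D q * (\<Sum>r\<in>{..<dR}. \<psi> (fst q, snd q, r) * cnj (\<psi> (fst q', snd q', r)))) = 0"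
      proof
        fix q' assume "q' \<in> ?C"
        from supported_on_column[OF fin sup this]
        have "op_apply ?C (swap_op d W) (\<lambda>p. \<rho> p q') (x, y) = s * \<rho> (x, y) q'" by metis
        moreover have "\<rho> q q' = (\<Sum>r<dR. \<psi> (fst q, snd q, r) * cnj (\<psi> (fst q', snd q', r)))" for q
          using pur unfolding purification_def ptrace_R_def by (auto simp: case_prod_unfold)
        ultimately show "(\<Sum>q\<in>?C. D q * (\<Sum>r\<in>{..<dR}. \<psi> (fst q, snd q, r) * cnj (\<psi> (fst q', snd q', r)))) = 0"
          unfolding D_sum op_apply_def by simp
      qed
    qed (use True in auto)
    then show ?thesis unfolding swapped D_sum by simp
  next
    case False
    then show ?thesis
      unfolding swapped using \<psi>0 by (auto simp: swap_op_def intro!: sum.neutral)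
  qed
qed

section \<open>Tensor powers and the exchange without ebits\<close>

lemma lists_of_Suc: "lists_of (Suc n) m = (\<lambda>(x, xs). x # xs) ` ({..<m} \<times> lists_of n m)"
proof (intro Set.set_eqI iffI)
  fix zs assume "zs \<in> lists_of (Suc n) m"
  then obtain x xs where zs: "zs = x # xs" "length xs = n" and "\<forall>i<Suc n. zs ! i < m"
    unfolding lists_of_def by (cases zs) auto
  then have "x < m" "\<forall>i<n. xs ! i < m" by (auto dest: spec[of _ 0] spec[of _ "Suc i" for i])
  then show "zs \<in> (\<lambda>(x, xs). x # xs) ` ({..<m} \<times> lists_of n m)"
    using zs unfolding lists_of_def by auto
next
  fix zs assume "zs \<in> (\<lambda>(x, xs). x # xs) ` ({..<m} \<times> lists_of n m)"
  then show "zs \<in> lists_of (Suc n) m"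
    unfolding lists_of_def by (auto simp: nth_Cons less_Suc_eq_0_disj split: nat.splits)
qed

lemma finite_lists_of: "finite (lists_of n m)"
proof (rule finite_subset)
  show "lists_of n m \<subseteq> {xs. set xs \<subseteq> {..<m} \<and> length xs = n}"
    unfolding lists_of_def by (auto simp: in_set_conv_nth)
qed (simp add: finite_lists_length_eq)

lemma sum_lists_of_prod:
  "(\<Sum>xs\<in>lists_of n m. \<Prod>i<n. f i (xs ! i)) = (\<Prod>i<n. \<Sum>a<m. (f i a :: 'a :: comm_semiring_1))"
proof (induction n arbitrary: f)
  case 0
  have "lists_of 0 m = {[]}" unfolding lists_of_def by auto
  then show ?case by simp
next
  case (Suc n)
  have inj: "inj_on (\<lambda>(x, xs). x # xs) ({..<m} \<times> lists_of n m)" by (auto simp: inj_on_def)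
  have "(\<Sum>xs\<in>lists_of (Suc n) m. \<Prod>i<Suc n. f i (xs ! i))
      = (\<Sum>x<m. \<Sum>xs\<in>lists_of n m. f 0 x * (\<Prod>i<n. f (Suc i) (xs ! i)))"
    unfolding lists_of_Suc sum.reindex[OF inj] sum.cartesian_product
    by (simp add: case_prod_unfold prod.lessThan_Suc_shift del: prod.lessThan_Suc)
  also have "\<dots> = (\<Sum>x<m. f 0 x) * (\<Prod>i<n. \<Sum>a<m. f (Suc i) a)"
    by (simp add: sum_distrib_left[symmetric] sum_distrib_right Suc.IH[of "\<lambda>i. f (Suc i)"])
  also have "\<dots> = (\<Prod>i<Suc n. \<Sum>a<m. f i a)"
    by (simp add: prod.lessThan_Suc_shift del: prod.lessThan_Suc)
  finally show ?case .
qed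

definition tensor_power :: "nat \<Rightarrow> nat \<Rightarrow> (nat \<times> nat \<times> nat \<Rightarrow> complex) \<Rightarrow> nat \<Rightarrow>
    nat list \<times> nat list \<times> nat list \<Rightarrow> complex" where
  "tensor_power d dR \<psi> n = (\<lambda>(xs, ys, rs). if (xs, ys, rs) \<in> out_carrier d dR n
     then \<Prod>i<n. \<psi> (xs ! i, ys ! i, rs ! i) else 0)"

lemma party_in_no_ebits: "party_in d n 0 = lists_of n d"
  unfolding party_in_def lists_of_def by auto

lemma input_vec_no_ebits: "input_vec d dR \<psi> n 0 = tensor_power d dR \<psi> n"
  unfolding input_vec_def tensor_power_def out_carrier_def party_in_no_ebits by (auto simp: fun_eq_iff)

lemma target_vec_eq_tensor_power: "target_vec d dR W \<psi> n = tensor_power d dR (swapped_pure d W \<psi>) n"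
  unfolding target_vec_def tensor_power_def out_carrier_def by (auto simp: fun_eq_iff)

lemma tensor_power_scale:
  "tensor_power d dR (\<lambda>p. s * \<psi> p) n = (\<lambda>c. s ^ n * tensor_power d dR \<psi> n c)"
  unfolding tensor_power_def by (auto simp: fun_eq_iff prod.distrib)

lemma unit_vec_tensor_power:
  assumes "unit_vec (ABR d dR) \<psi>"
  shows "unit_vec (out_carrier d dR n) (tensor_power d dR \<psi> n)"
proof -
  let ?q = "\<lambda>p. (cmod (\<psi> p))\<^sup>2"
  have "(\<Sum>c\<in>out_carrier d dR n. (cmod (tensor_power d dR \<psi> n c))\<^sup>2)
      = (\<Sum>xs\<in>lists_of n d. \<Sum>ys\<in>lists_of n d. \<Sum>rs\<in>lists_of n dR. \<Prod>i<n. ?q (xs ! i, ys ! i, rs ! i))"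
    unfolding out_carrier_def sum.cartesian_product
    by (intro sum.cong refl)
      (auto simp: tensor_power_def out_carrier_def prod_norm[symmetric] prod_power_distrib)
  also have "\<dots> = (\<Sum>xs\<in>lists_of n d. \<Sum>ys\<in>lists_of n d. \<Prod>i<n. \<Sum>r<dR. ?q (xs ! i, ys ! i, r))"
    by (intro sum.cong refl sum_lists_of_prod)
  also have "\<dots> = (\<Sum>xs\<in>lists_of n d. \<Prod>i<n. \<Sum>b<d. \<Sum>r<dR. ?q (xs ! i, b, r))"
    by (intro sum.cong refl sum_lists_of_prod)
  also have "\<dots> = (\<Prod>i<n. \<Sum>a<d. \<Sum>b<d. \<Sum>r<dR. ?q (a, b, r))"
    by (rule sum_lists_of_prod)
  also have "(\<Sum>a<d. \<Sum>b<d. \<Sum>r<dR. ?q (a, b, r)) = (\<Sum>p\<in>ABR d dR. ?q p)"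
    unfolding ABR_def by (simp add: sum.cartesian_product atLeast0LessThan case_prod_unfold)
  finally show ?thesis
    using assms unfolding Defs.unit_vec_def is_vec_def tensor_power_def by auto
qed

lemma outer_unimodular_scale:
  assumes "cmod c = 1"
  shows "outer (\<lambda>x. c * v x) = outer v"
proof -
  have "c * cnj c = 1" using assms complex_norm_square[of c] by simp
  then show ?thesis unfolding outer_def by (simp add: fun_eq_iff algebra_simps)
qed

lemma achievable_rate_nonneg:
  assumes "achievable_rate d dR W \<psi> r"
  shows "0 \<le> r"
proof -
  obtain k :: "nat \<Rightarrow> nat" where "limsup (\<lambda>n. ereal (real (k n) / real n)) \<le> ereal r"
    using assms unfolding achievable_rate_def by blast
  moreover have "0 \<le> limsup (\<lambda>n. ereal (real (k n) / real n))"
    by (rule le_Limsup) auto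
  ultimately have "ereal 0 \<le> ereal r"
    using order_trans zero_ereal_def by metis
  then show ?thesis by simp
qed

lemma uncommon_info_eq_0_if_achievable:
  assumes "achievable_rate d dR W \<psi> 0"
  shows "uncommon_info d dR W \<psi> = 0"
  unfolding uncommon_info_def
  using assms achievable_rate_nonneg by (intro cInf_eq_minimum) auto

lemma uncommon_info_eq_0_if_swap_phase:
  assumes \<psi>: "unit_vec (ABR d dR) \<psi>"
    and swap: "swapped_pure d W \<psi> = (\<lambda>p. s * \<psi> p)" and s: "cmod s = 1"
  shows "uncommon_info d dR W \<psi> = 0"
proof (rule uncommon_info_eq_0_if_achievable)
  have fid: "fidelity (out_carrier d dR n) (outer (input_vec d dR \<psi> n 0)) (outer (target_vec d dR W \<psi> n)) = 1" for n
  proof -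
    have "outer (target_vec d dR W \<psi> n) = outer (tensor_power d dR \<psi> n)"
      unfolding target_vec_eq_tensor_power swap tensor_power_scale
      using s by (simp add: outer_unimodular_scale norm_power)
    moreover have "finite (out_carrier d dR n)"
      unfolding out_carrier_def by (simp add: finite_lists_of)
    ultimately show ?thesis
      unfolding input_vec_no_ebits using fidelity_outer_self unit_vec_tensor_power[OF \<psi>] by metis
  qed
  show "achievable_rate d dR W \<psi> 0"
    unfolding achievable_rate_def
    by (intro exI[of _ "\<lambda>_. 0"] exI[of _ "\<lambda>_ \<rho>. \<rho>"])
      (simp add: party_in_no_ebits locc_id finite_lists_of fid Limsup_const)
qed

section \<open>Unitary symmetrization of complex square matrices\<close>

lemma semiring_hom_cnj: "semiring_hom cnj"
  by unfold_locales simp_all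

lemma comm_ring_hom_cnj: "comm_ring_hom cnj"
  by unfold_locales simp_all

lemma dim_mat_adjoint[simp]:
  "dim_row (mat_adjoint A) = dim_col A" "dim_col (mat_adjoint A) = dim_row A"
  unfolding mat_adjoint_def by simp_all

lemma index_mat_adjoint[simp]:
  "i < dim_col A \<Longrightarrow> j < dim_row A \<Longrightarrow> mat_adjoint A $$ (i, j) = conjugate (A $$ (j, i))"
  unfolding mat_adjoint_def by (simp add: mat_of_rows_index)

lemma mat_adjoint_carrier[simp]: "A \<in> carrier_mat n m \<Longrightarrow> mat_adjoint A \<in> carrier_mat m n"
  unfolding carrier_mat_def by simp

lemma mat_adjoint_conv: "mat_adjoint (A :: complex mat) = (map_mat cnj A)\<^sup>T"
  by (rule eq_matI) simp_all

lemma mat_adjoint_adjoint[simp]: "mat_adjoint (mat_adjoint A) = A"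
  by (rule eq_matI) simp_all

lemma mat_adjoint_zero[simp]: "mat_adjoint (0\<^sub>m n m) = 0\<^sub>m m n"
  by (rule eq_matI) simp_all

lemma mat_adjoint_transpose: "mat_adjoint (A\<^sup>T) = (mat_adjoint A)\<^sup>T"
  by (rule eq_matI) simp_all

lemma mat_adjoint_mult:
  fixes A B :: "complex mat"
  assumes "A \<in> carrier_mat n k" "B \<in> carrier_mat k m"
  shows "mat_adjoint (A * B) = mat_adjoint B * mat_adjoint A"
  using assms unfolding mat_adjoint_conv
  by (simp add: semiring_hom.mat_hom_mult[OF semiring_hom_cnj assms] transpose_mult[of _ n k _ m])

lemma det_mat_adjoint:
  fixes A :: "complex mat"
  assumes "A \<in> carrier_mat n n"
  shows "det (mat_adjoint A) = cnj (det A)"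
  using assms unfolding mat_adjoint_conv
  by (simp add: det_transpose comm_ring_hom.hom_det[OF comm_ring_hom_cnj])

lemma mat_adjoint_four_block_mat:
  assumes "A \<in> carrier_mat n1 m1" "B \<in> carrier_mat n1 m2" "C \<in> carrier_mat n2 m1" "D \<in> carrier_mat n2 m2"
  shows "mat_adjoint (four_block_mat A B C D)
    = four_block_mat (mat_adjoint A) (mat_adjoint C) (mat_adjoint B) (mat_adjoint D)"
  using assms by (intro eq_matI) auto

definition unitary_mat :: "nat \<Rightarrow> complex mat \<Rightarrow> bool" where
  "unitary_mat n U \<longleftrightarrow> U \<in> carrier_mat n n \<and> mat_adjoint U * U = 1\<^sub>m n \<and> U * mat_adjoint U = 1\<^sub>m n"

lemma unitary_matI:
  assumes "U \<in> carrier_mat n n" "mat_adjoint U * U = 1\<^sub>m n"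
  shows "unitary_mat n U"
  using assms mat_mult_left_right_inverse[of "mat_adjoint U" n U] unfolding unitary_mat_def by auto

lemma unitary_mat_carrier: "unitary_mat n U \<Longrightarrow> U \<in> carrier_mat n n"
  unfolding unitary_mat_def by simp

lemma unitary_mat_cancel:
  assumes "unitary_mat n U" "X \<in> carrier_mat n m"
  shows "mat_adjoint U * (U * X) = X" "U * (mat_adjoint U * X) = X"
  using assms unfolding unitary_mat_def
  by (auto simp flip: assoc_mult_mat[of _ n n _ n X m])

lemma unitary_mat_mult:
  assumes "unitary_mat n U" "unitary_mat n V"
  shows "unitary_mat n (U * V)"
proof (rule unitary_matI)
  have U: "U \<in> carrier_mat n n" and V: "V \<in> carrier_mat n n"
    using assms by (simp_all add: unitary_mat_carrier)
  then show "U * V \<in> carrier_mat n n" by simp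
  have "mat_adjoint (U * V) * (U * V) = mat_adjoint V * (mat_adjoint U * (U * V))"
    using U V by (simp add: mat_adjoint_mult
        assoc_mult_mat[OF mat_adjoint_carrier[OF V] mat_adjoint_carrier[OF U] mult_carrier_mat[OF U V]])
  also have "\<dots> = 1\<^sub>m n"
    using assms V unfolding unitary_mat_cancel[OF assms(1) V] unitary_mat_def by simp
  finally show "mat_adjoint (U * V) * (U * V) = 1\<^sub>m n" .
qed

lemma unitary_mat_adjoint: "unitary_mat n U \<Longrightarrow> unitary_mat n (mat_adjoint U)"
  unfolding unitary_mat_def by auto

lemma unitary_mat_transpose:
  assumes "unitary_mat n U"
  shows "unitary_mat n U\<^sup>T"
proof (rule unitary_matI)
  have U: "U \<in> carrier_mat n n" by (rule unitary_mat_carrier[OF assms])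
  then show "U\<^sup>T \<in> carrier_mat n n" by simp
  have "mat_adjoint U\<^sup>T * U\<^sup>T = (U * mat_adjoint U)\<^sup>T"
    using U by (simp add: mat_adjoint_transpose transpose_mult[of _ n n _ n])
  then show "mat_adjoint U\<^sup>T * U\<^sup>T = 1\<^sub>m n"
    using assms unfolding unitary_mat_def by simp
qed

lemma unitary_mat_four_block_mat:
  assumes "unitary_mat n1 A" "unitary_mat n2 B"
  shows "unitary_mat (n1 + n2) (four_block_mat A (0\<^sub>m n1 n2) (0\<^sub>m n2 n1) B)"
proof (rule unitary_matI)
  have A: "A \<in> carrier_mat n1 n1" and B: "B \<in> carrier_mat n2 n2"
    using assms by (simp_all add: unitary_mat_carrier)
  then show "four_block_mat A (0\<^sub>m n1 n2) (0\<^sub>m n2 n1) B \<in> carrier_mat (n1 + n2) (n1 + n2)"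
    by simp
  have "mat_adjoint (four_block_mat A (0\<^sub>m n1 n2) (0\<^sub>m n2 n1) B)
      = four_block_mat (mat_adjoint A) (0\<^sub>m n1 n2) (0\<^sub>m n2 n1) (mat_adjoint B)"
    using mat_adjoint_four_block_mat[OF A _ _ B, of "0\<^sub>m n1 n2" "0\<^sub>m n2 n1"] by simp
  then show "mat_adjoint (four_block_mat A (0\<^sub>m n1 n2) (0\<^sub>m n2 n1) B) * four_block_mat A (0\<^sub>m n1 n2) (0\<^sub>m n2 n1) B
      = 1\<^sub>m (n1 + n2)"
    using assms unfolding unitary_mat_def
    by (simp add: mult_four_block_mat[OF mat_adjoint_carrier[OF A] _ _ mat_adjoint_carrier[OF B] A _ _ B]
        A B left_mult_zero_mat[OF A] left_mult_zero_mat[OF B]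
        right_mult_zero_mat[OF mat_adjoint_carrier[OF A]] right_mult_zero_mat[OF mat_adjoint_carrier[OF B]])
qed

definition unitarily_symmetrizable :: "nat \<Rightarrow> complex mat \<Rightarrow> bool" where
  "unitarily_symmetrizable n A \<longleftrightarrow> (\<exists>W. unitary_mat n W \<and> (W * A)\<^sup>T = W * A)"

lemma transpose_congruence_symmetric:
  fixes S V :: "'a :: comm_semiring_1 mat"
  assumes S: "S \<in> carrier_mat n n" and "S\<^sup>T = S" and V: "V \<in> carrier_mat n n"
  shows "(V\<^sup>T * S * V)\<^sup>T = V\<^sup>T * S * V"
proof -
  have VT: "V\<^sup>T \<in> carrier_mat n n" using V by simp
  have "(V\<^sup>T * S * V)\<^sup>T = V\<^sup>T * (V\<^sup>T * S)\<^sup>T"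
    by (rule transpose_mult[OF mult_carrier_mat[OF VT S] V])
  also have "(V\<^sup>T * S)\<^sup>T = S * V"
    using transpose_mult[OF VT S] \<open>S\<^sup>T = S\<close> by simp
  also have "V\<^sup>T * (S * V) = V\<^sup>T * S * V"
    using VT S V by simp
  finally show ?thesis .
qed

text \<open>If \<open>W A\<close> is symmetric, so is \<open>V\<^sup>T (W A) V = (V\<^sup>T W U\<^sup>\<dagger>) (U A V)\<close>.\<close>
lemma unitarily_symmetrizable_unitary_mult:
  assumes A: "A \<in> carrier_mat n n" and sym: "unitarily_symmetrizable n A"
    and U: "unitary_mat n U" and V: "unitary_mat n V"
  shows "unitarily_symmetrizable n (U * A * V)"
proof -
  obtain W where W: "unitary_mat n W" and WA: "(W * A)\<^sup>T = W * A"
    using sym unfolding unitarily_symmetrizable_def by blast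
  have Uc: "U \<in> carrier_mat n n" and Vc: "V \<in> carrier_mat n n" and Wc: "W \<in> carrier_mat n n"
    using U V W by (simp_all add: unitary_mat_carrier)
  define W' where "W' = V\<^sup>T * W * mat_adjoint U"
  have "unitary_mat n W'"
    unfolding W'_def by (intro unitary_mat_mult unitary_mat_transpose unitary_mat_adjoint V W U)
  moreover have W'UAV: "W' * (U * A * V) = V\<^sup>T * (W * A) * V"
    unfolding W'_def using A Uc Vc Wc unitary_mat_cancel(1)[OF U, of "A * V" n]
    by (simp add: assoc_mult_mat[of _ n n _ n _ n])
  moreover have "(V\<^sup>T * (W * A) * V)\<^sup>T = V\<^sup>T * (W * A) * V"
    using A Wc by (intro transpose_congruence_symmetric[OF _ WA Vc]) simp
  ultimately show ?thesis
    unfolding unitarily_symmetrizable_def by metis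
qed

lemma unitarily_symmetrizable_four_block_mat:
  assumes A: "A \<in> carrier_mat n1 n1" and B: "B \<in> carrier_mat n2 n2"
    and "unitarily_symmetrizable n1 A" "unitarily_symmetrizable n2 B"
  shows "unitarily_symmetrizable (n1 + n2) (four_block_mat A (0\<^sub>m n1 n2) (0\<^sub>m n2 n1) B)"
proof -
  obtain WA WB where WA: "unitary_mat n1 WA" "(WA * A)\<^sup>T = WA * A"
    and WB: "unitary_mat n2 WB" "(WB * B)\<^sup>T = WB * B"
    using assms(3,4) unfolding unitarily_symmetrizable_def by blast
  have WAc: "WA \<in> carrier_mat n1 n1" and WBc: "WB \<in> carrier_mat n2 n2"
    using WA WB by (simp_all add: unitary_mat_carrier)
  have prod: "four_block_mat WA (0\<^sub>m n1 n2) (0\<^sub>m n2 n1) WB * four_block_mat A (0\<^sub>m n1 n2) (0\<^sub>m n2 n1) B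
      = four_block_mat (WA * A) (0\<^sub>m n1 n2) (0\<^sub>m n2 n1) (WB * B)"
    by (simp add: mult_four_block_mat[OF WAc _ _ WBc A _ _ B] left_mult_zero_mat[OF A]
        left_mult_zero_mat[OF B] right_mult_zero_mat[OF WAc] right_mult_zero_mat[OF WBc]
        mult_carrier_mat[OF WAc A] mult_carrier_mat[OF WBc B])
  have "(four_block_mat (WA * A) (0\<^sub>m n1 n2) (0\<^sub>m n2 n1) (WB * B))\<^sup>T
      = four_block_mat (WA * A) (0\<^sub>m n1 n2) (0\<^sub>m n2 n1) (WB * B)"
    using WAc WBc A B WA(2) WB(2)
    by (simp add: transpose_four_block_mat[of _ n1 n1 _ n2 _ n2])
  then show ?thesis
    using unitary_mat_four_block_mat[OF WA(1) WB(1)] prod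
    unfolding unitarily_symmetrizable_def by metis
qed

lemma unitarily_symmetrizable_1:
  assumes "A \<in> carrier_mat 1 1"
  shows "unitarily_symmetrizable 1 A"
  unfolding unitarily_symmetrizable_def
proof (intro exI conjI)
  show "unitary_mat 1 (1\<^sub>m 1)" by (rule unitary_matI) auto
  show "(1\<^sub>m 1 * A)\<^sup>T = 1\<^sub>m 1 * A" using assms by (intro eq_matI) auto
qed

lemma cscalar_prod_smult_self:
  fixes v :: "complex vec"
  assumes "v \<in> carrier_vec n"
  shows "(c \<cdot>\<^sub>v v) \<bullet>c (c \<cdot>\<^sub>v v) = c * cnj c * (v \<bullet>c v)"
  using assms by (simp add: conjugate_smult_vec)

lemma exists_unit_multiple:
  fixes v :: "complex vec"
  assumes v: "v \<in> carrier_vec n" "v \<noteq> 0\<^sub>v n"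
  shows "\<exists>c. c \<noteq> 0 \<and> (c \<cdot>\<^sub>v v) \<bullet>c (c \<cdot>\<^sub>v v) = 1"
proof -
  have "v \<bullet>c v > 0" using v by simp
  then obtain s where s: "v \<bullet>c v = of_real s" "0 < s"
    by (auto simp: less_complex_def complex_eq_iff intro: that[of "Re (v \<bullet>c v)"])
  define c where "c = complex_of_real (1 / sqrt s)"
  have "c * cnj c * (v \<bullet>c v) = 1"
    unfolding c_def s(1) using s(2) by (simp flip: of_real_mult)
  then have "(c \<cdot>\<^sub>v v) \<bullet>c (c \<cdot>\<^sub>v v) = 1"
    unfolding cscalar_prod_smult_self[OF v(1)] .
  moreover have "c \<noteq> 0" unfolding c_def using s(2) by simp
  ultimately show ?thesis by blast
qed

lemma index_mat_adjoint_mult_self: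
  fixes A :: "complex mat"
  assumes "A \<in> carrier_mat n m" "i < m" "j < m"
  shows "(mat_adjoint A * A) $$ (i, j) = col A j \<bullet>c col A i"
  using assms by (simp add: scalar_prod_def mult.commute)

lemma unitary_mat_of_orthonormal_cols:
  assumes U: "U \<in> carrier_mat n n"
    and orth: "\<And>i j. i < n \<Longrightarrow> j < n \<Longrightarrow> col U j \<bullet>c col U i = (if i = j then 1 else 0)"
  shows "unitary_mat n U"
proof (rule unitary_matI[OF U], rule eq_matI)
  fix i j assume "i < dim_row (1\<^sub>m n)" "j < dim_col (1\<^sub>m n)"
  then show "(mat_adjoint U * U) $$ (i, j) = 1\<^sub>m n $$ (i, j)"
    using orth index_mat_adjoint_mult_self[OF U] by simp
qed (use U in simp_all)

lemma unitary_mat_of_corthogonal: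
  fixes ws :: "complex vec list"
  assumes orth: "corthogonal ws" and wsc: "set ws \<subseteq> carrier_vec n" and lenw: "length ws = n"
    and n: "0 < n" and unit0: "ws ! 0 \<bullet>c ws ! 0 = 1"
  shows "\<exists>U. unitary_mat n U \<and> col U 0 = ws ! 0"
proof -
  have wsj: "ws ! j \<in> carrier_vec n" "ws ! j \<noteq> 0\<^sub>v n" if "j < n" for j
  proof -
    show "ws ! j \<in> carrier_vec n" using wsc that lenw by auto
    then show "ws ! j \<noteq> 0\<^sub>v n" using corthogonalD[OF orth, of j j] that lenw by auto
  qed
  have "\<forall>j\<in>{..<n}. \<exists>c. c \<noteq> 0 \<and> (c \<cdot>\<^sub>v ws ! j) \<bullet>c (c \<cdot>\<^sub>v ws ! j) = 1 \<and> (j = 0 \<longrightarrow> c = 1)"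
  proof
    fix j assume "j \<in> {..<n}"
    then obtain c where "c \<noteq> 0" "(c \<cdot>\<^sub>v ws ! j) \<bullet>c (c \<cdot>\<^sub>v ws ! j) = 1"
      using exists_unit_multiple[OF wsj] by blast
    then show "\<exists>c. c \<noteq> 0 \<and> (c \<cdot>\<^sub>v ws ! j) \<bullet>c (c \<cdot>\<^sub>v ws ! j) = 1 \<and> (j = 0 \<longrightarrow> c = 1)"
      using unit0 wsj[OF n] by (cases "j = 0") (auto intro: exI[of _ 1])
  qed
  from bchoice[OF this] obtain c where
    c: "\<forall>j\<in>{..<n}. c j \<noteq> 0 \<and> (c j \<cdot>\<^sub>v ws ! j) \<bullet>c (c j \<cdot>\<^sub>v ws ! j) = 1 \<and> (j = 0 \<longrightarrow> c j = 1)"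
    by blast
  define U where "U = mat_of_cols n (map (\<lambda>j. c j \<cdot>\<^sub>v ws ! j) [0..<n])"
  have colU: "col U j = c j \<cdot>\<^sub>v ws ! j" if "j < n" for j
    unfolding U_def using that wsj[OF that] by simp
  have "unitary_mat n U"
  proof (rule unitary_mat_of_orthonormal_cols)
    show "U \<in> carrier_mat n n" unfolding U_def carrier_mat_def by simp
    fix i j assume ij: "i < n" "j < n"
    show "col U j \<bullet>c col U i = (if i = j then 1 else 0)"
    proof (cases "i = j")
      case False
      have "col U j \<bullet>c col U i = c j * cnj (c i) * (ws ! j \<bullet>c ws ! i)"
        unfolding colU[OF ij(1)] colU[OF ij(2)] using wsj[OF ij(1)] wsj[OF ij(2)]
        by (simp add: conjugate_smult_vec)
      also have "ws ! j \<bullet>c ws ! i = 0"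
        using corthogonalD[OF orth, of j i] ij lenw False by simp
      finally show ?thesis using False by simp
    qed (use c ij(2) colU[OF ij(2)] in simp)
  qed
  moreover have "col U 0 = ws ! 0"
    using colU[OF n] c n wsj[OF n] by simp
  ultimately show ?thesis by blast
qed

lemma unitary_mat_with_first_col:
  fixes u :: "complex vec"
  assumes u: "u \<in> carrier_vec n" and nu: "u \<bullet>c u = 1"
  shows "\<exists>U. unitary_mat n U \<and> col U 0 = u"
proof -
  interpret cof_vec_space n "TYPE(complex)" .
  have u0: "u \<noteq> 0\<^sub>v n" using nu by auto
  have n: "0 < n"
  proof (rule ccontr)
    assume "\<not> 0 < n"
    then have "u = 0\<^sub>v n" using u by (intro eq_vecI) auto
    with u0 show False by simp
  qed
  define b where "b = basis_completion u"
  from basis_completion[OF u u0, folded b_def]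
  have b: "distinct b" "\<not> lin_dep (set b)" "set b \<subseteq> carrier_vec n" "hd b = u" "length b = n"
    by auto
  with n obtain vs where bv: "b = u # vs" by (cases b) auto
  define ws where "ws = gram_schmidt n b"
  from gram_schmidt_result[OF b(3,1,2) refl, folded ws_def]
  have orth: "corthogonal ws" and wsc: "set ws \<subseteq> carrier_vec n" and lenw: "length ws = n"
    using b(5) by auto
  have "ws ! 0 = u"
    using gram_schmidt_hd[OF u, of vs] n lenw unfolding ws_def bv
    by (cases "gram_schmidt n (u # vs)") auto
  then show ?thesis
    using unitary_mat_of_corthogonal[OF orth wsc lenw n] nu by simp
qed

lemma exists_unit_eigenvector:
  fixes A :: "complex mat"
  assumes A: "A \<in> carrier_mat n n" and n: "0 < n"
  shows "\<exists>q l. q \<in> carrier_vec n \<and> q \<bullet>c q = 1 \<and> A *\<^sub>v q = l \<cdot>\<^sub>v q"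
proof -
  have "degree (char_poly A) = n" using degree_monic_char_poly[OF A] by simp
  then obtain l where "poly (char_poly A) l = 0"
    using n fundamental_theorem_of_algebra constant_degree by (metis neq0_conv)
  then obtain q0 where "eigenvector A q0 l"
    using eigenvalue_root_char_poly[OF A] unfolding eigenvalue_def by blast
  then have q0: "q0 \<in> carrier_vec n" "q0 \<noteq> 0\<^sub>v n" "A *\<^sub>v q0 = l \<cdot>\<^sub>v q0"
    unfolding eigenvector_def using A by auto
  obtain c where c: "c \<noteq> 0" "(c \<cdot>\<^sub>v q0) \<bullet>c (c \<cdot>\<^sub>v q0) = 1"
    using exists_unit_multiple[OF q0(1,2)] by blast
  have "A *\<^sub>v (c \<cdot>\<^sub>v q0) = l \<cdot>\<^sub>v (c \<cdot>\<^sub>v q0)"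
    unfolding mult_mat_vec[OF A q0(1)] q0(3) by (simp add: smult_smult_assoc mult.commute)
  then show ?thesis using q0(1) c(2) by (intro exI[of _ "c \<cdot>\<^sub>v q0"]) auto
qed

lemma exists_unit_kernel_vec:
  fixes A :: "complex mat"
  assumes A: "A \<in> carrier_mat n n" and "det A = 0"
  shows "\<exists>u. u \<in> carrier_vec n \<and> u \<bullet>c u = 1 \<and> A *\<^sub>v u = 0\<^sub>v n"
proof -
  obtain u0 where u0: "u0 \<in> carrier_vec n" "u0 \<noteq> 0\<^sub>v n" "A *\<^sub>v u0 = 0\<^sub>v n"
    using det_0_iff_vec_prod_zero[OF A] assms(2) by blast
  obtain d where "(d \<cdot>\<^sub>v u0) \<bullet>c (d \<cdot>\<^sub>v u0) = 1"
    using exists_unit_multiple[OF u0(1,2)] by blast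
  moreover have "A *\<^sub>v (d \<cdot>\<^sub>v u0) = 0\<^sub>v n"
    using u0 A by (intro eq_vecI) (simp_all add: mult_mat_vec[OF A])
  ultimately show ?thesis using u0(1) by (intro exI[of _ "d \<cdot>\<^sub>v u0"]) auto
qed

text \<open>The first vector \<open>q\<close> is a unit eigenvector of \<open>A\<^sup>\<dagger> A\<close>. If \<open>A q \<noteq> 0\<close>, \<open>u\<close> is \<open>A q\<close> normalised;
  otherwise \<open>A\<close> is singular and \<open>u\<close> is taken from the kernel of \<open>A\<^sup>\<dagger>\<close>.\<close>
lemma singular_pair_exists:
  fixes A :: "complex mat"
  assumes A: "A \<in> carrier_mat n n" and n: "0 < n"
  shows "\<exists>q u \<sigma> \<tau>. q \<in> carrier_vec n \<and> u \<in> carrier_vec n \<and> q \<bullet>c q = 1 \<and> u \<bullet>c u = 1 \<and>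
           A *\<^sub>v q = \<sigma> \<cdot>\<^sub>v u \<and> mat_adjoint A *\<^sub>v u = \<tau> \<cdot>\<^sub>v q"
proof -
  have AA: "mat_adjoint A * A \<in> carrier_mat n n"
    using mult_carrier_mat[OF mat_adjoint_carrier[OF A] A] .
  obtain q l where q: "q \<in> carrier_vec n" "q \<bullet>c q = 1" and "(mat_adjoint A * A) *\<^sub>v q = l \<cdot>\<^sub>v q"
    using exists_unit_eigenvector[OF AA n] by blast
  then have Gq: "mat_adjoint A *\<^sub>v (A *\<^sub>v q) = l \<cdot>\<^sub>v q"
    using assoc_mult_mat_vec[OF mat_adjoint_carrier[OF A] A q(1)] by simp
  show ?thesis
  proof (cases "A *\<^sub>v q = 0\<^sub>v n")
    case True
    have "q \<noteq> 0\<^sub>v n" using q(2) by auto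
    then have "det (mat_adjoint A) = 0"
      using True det_0_iff_vec_prod_zero[OF A] q(1) det_mat_adjoint[OF A] by auto
    then obtain u where u: "u \<in> carrier_vec n" "u \<bullet>c u = 1" "mat_adjoint A *\<^sub>v u = 0\<^sub>v n"
      using exists_unit_kernel_vec[OF mat_adjoint_carrier[OF A]] by blast
    have "A *\<^sub>v q = 0 \<cdot>\<^sub>v u" "mat_adjoint A *\<^sub>v u = 0 \<cdot>\<^sub>v q"
      using True u q by (auto intro!: eq_vecI)
    then show ?thesis using q u by blast
  next
    case False
    obtain d where d: "d \<noteq> 0" "(d \<cdot>\<^sub>v (A *\<^sub>v q)) \<bullet>c (d \<cdot>\<^sub>v (A *\<^sub>v q)) = 1"
      using exists_unit_multiple[OF _ False] A q by auto
    have "A *\<^sub>v q = (1 / d) \<cdot>\<^sub>v (d \<cdot>\<^sub>v (A *\<^sub>v q))"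
      using d(1) by (simp add: smult_smult_assoc)
    moreover have "mat_adjoint A *\<^sub>v (d \<cdot>\<^sub>v (A *\<^sub>v q)) = (d * l) \<cdot>\<^sub>v q"
      using A q Gq by (simp add: mult_mat_vec[OF mat_adjoint_carrier[OF A]] smult_smult_assoc)
    moreover have "d \<cdot>\<^sub>v (A *\<^sub>v q) \<in> carrier_vec n" using A q by simp
    ultimately show ?thesis
      using q d by blast
  qed
qed

lemma col_adjoint_mult_mult:
  fixes A :: "complex mat"
  assumes A: "A \<in> carrier_mat n n" and U: "unitary_mat n U" and V: "unitary_mat n V" and n: "0 < n"
    and AV: "A *\<^sub>v col V 0 = \<sigma> \<cdot>\<^sub>v col U 0"
  shows "col (mat_adjoint U * A * V) 0 = \<sigma> \<cdot>\<^sub>v Matrix.unit_vec n 0"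
proof -
  have Uc: "U \<in> carrier_mat n n" and Vc: "V \<in> carrier_mat n n"
    using U V by (simp_all add: unitary_mat_carrier)
  have "col (mat_adjoint U * A * V) 0 = (mat_adjoint U * A) *\<^sub>v col V 0"
    using col_mult2[OF mult_carrier_mat[OF mat_adjoint_carrier[OF Uc] A] Vc n] .
  also have "\<dots> = mat_adjoint U *\<^sub>v (A *\<^sub>v col V 0)"
    using assoc_mult_mat_vec[OF mat_adjoint_carrier[OF Uc] A] Vc n by simp
  also have "\<dots> = \<sigma> \<cdot>\<^sub>v col (mat_adjoint U * U) 0"
    unfolding AV using Uc n col_mult2[OF mat_adjoint_carrier[OF Uc] Uc n]
    by (simp add: mult_mat_vec[OF mat_adjoint_carrier[OF Uc]])
  also have "mat_adjoint U * U = 1\<^sub>m n"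
    using U unfolding unitary_mat_def by simp
  finally show ?thesis using n by simp
qed

lemma four_block_mat_if_first_row_col_zero:
  assumes Pc: "P \<in> carrier_mat (Suc m) (Suc m)"
    and col0: "\<And>i. i < m \<Longrightarrow> P $$ (Suc i, 0) = 0" and row0: "\<And>j. j < m \<Longrightarrow> P $$ (0, Suc j) = 0"
  shows "\<exists>a B. a \<in> carrier_mat 1 1 \<and> B \<in> carrier_mat m m \<and> P = four_block_mat a (0\<^sub>m 1 m) (0\<^sub>m m 1) B"
proof -
  obtain a P2 P3 B where split: "split_block P 1 1 = (a, P2, P3, B)"
    by (metis prod_cases4)
  note blocks = split_block[OF split, of m m]
  have a: "a \<in> carrier_mat 1 1" and B: "B \<in> carrier_mat m m" and P: "P = four_block_mat a P2 P3 B"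
    using blocks Pc by auto
  have "P2 = 0\<^sub>m 1 m"
  proof (rule eq_matI)
    fix i j assume ij: "i < dim_row (0\<^sub>m 1 m :: 'a mat)" "j < dim_col (0\<^sub>m 1 m :: 'a mat)"
    have "P $$ (0, Suc j) = P2 $$ (0, j)"
      unfolding P using a B ij by simp
    then show "P2 $$ (i, j) = 0\<^sub>m 1 m $$ (i, j)"
      using row0 ij by simp
  qed (use blocks Pc in auto)
  moreover have "P3 = 0\<^sub>m m 1"
  proof (rule eq_matI)
    fix i j assume ij: "i < dim_row (0\<^sub>m m 1 :: 'a mat)" "j < dim_col (0\<^sub>m m 1 :: 'a mat)"
    have "P $$ (Suc i, 0) = P3 $$ (i, 0)"
      unfolding P using a B ij by simp
    then show "P3 $$ (i, j) = 0\<^sub>m m 1 $$ (i, j)"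
      using col0 ij by simp
  qed (use blocks Pc in auto)
  ultimately show ?thesis using a B P by blast
qed

text \<open>In orthonormal bases starting with a singular pair \<open>q\<close>, \<open>u\<close>, the matrix \<open>A\<close> has vanishing
  first row and column apart from the corner entry.\<close>
lemma unitary_block_decomposition:
  fixes A :: "complex mat"
  assumes A: "A \<in> carrier_mat (Suc m) (Suc m)"
  shows "\<exists>U V a B. unitary_mat (Suc m) U \<and> unitary_mat (Suc m) V \<and>
           a \<in> carrier_mat 1 1 \<and> B \<in> carrier_mat m m \<and>
           A = U * four_block_mat a (0\<^sub>m 1 m) (0\<^sub>m m 1) B * V"
proof -
  let ?n = "Suc m"
  obtain q u \<sigma> \<tau> where q: "q \<in> carrier_vec ?n" "q \<bullet>c q = 1" and u: "u \<in> carrier_vec ?n" "u \<bullet>c u = 1"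
    and Aq: "A *\<^sub>v q = \<sigma> \<cdot>\<^sub>v u" and Au: "mat_adjoint A *\<^sub>v u = \<tau> \<cdot>\<^sub>v q"
    using singular_pair_exists[OF A] by blast
  obtain U where U: "unitary_mat ?n U" and Ucol: "col U 0 = u"
    using unitary_mat_with_first_col[OF u] by blast
  obtain V where V: "unitary_mat ?n V" and Vcol: "col V 0 = q"
    using unitary_mat_with_first_col[OF q] by blast
  have Uc: "U \<in> carrier_mat ?n ?n" and Vc: "V \<in> carrier_mat ?n ?n"
    using U V by (simp_all add: unitary_mat_carrier)
  define P where "P = mat_adjoint U * A * V"
  have Pc: "P \<in> carrier_mat ?n ?n"
    unfolding P_def using Uc Vc A by (simp add: mult_carrier_mat[of _ ?n ?n])
  have "A *\<^sub>v col V 0 = \<sigma> \<cdot>\<^sub>v col U 0" using Aq Ucol Vcol by simp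
  then have colP: "col P 0 = \<sigma> \<cdot>\<^sub>v Matrix.unit_vec ?n 0"
    unfolding P_def by (rule col_adjoint_mult_mult[OF A U V zero_less_Suc])
  have "mat_adjoint P = mat_adjoint V * mat_adjoint (mat_adjoint U * A)"
    unfolding P_def by (rule mat_adjoint_mult[OF mult_carrier_mat[OF mat_adjoint_carrier[OF Uc] A] Vc])
  also have "\<dots> = mat_adjoint V * mat_adjoint A * U"
    using mat_adjoint_mult[OF mat_adjoint_carrier[OF Uc] A] Uc Vc A
    by (simp add: assoc_mult_mat[of _ ?n ?n _ ?n _ ?n])
  finally have adjP: "mat_adjoint P = mat_adjoint V * mat_adjoint A * U" .
  have "mat_adjoint A *\<^sub>v col U 0 = \<tau> \<cdot>\<^sub>v col V 0" using Au Ucol Vcol by simp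
  then have colP': "col (mat_adjoint P) 0 = \<tau> \<cdot>\<^sub>v Matrix.unit_vec ?n 0"
    unfolding adjP by (rule col_adjoint_mult_mult[OF mat_adjoint_carrier[OF A] V U zero_less_Suc])
  have "P $$ (Suc i, 0) = 0" if "i < m" for i
  proof -
    have "P $$ (Suc i, 0) = col P 0 $ Suc i" using Pc that by simp
    then show ?thesis using colP that by simp
  qed
  moreover have "P $$ (0, Suc j) = 0" if "j < m" for j
  proof -
    have "cnj (P $$ (0, Suc j)) = col (mat_adjoint P) 0 $ Suc j" using Pc that by simp
    then show ?thesis using colP' that by simp
  qed
  ultimately obtain a B where a: "a \<in> carrier_mat 1 1" and B: "B \<in> carrier_mat m m"
    and P: "P = four_block_mat a (0\<^sub>m 1 m) (0\<^sub>m m 1) B"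
    using four_block_mat_if_first_row_col_zero[OF Pc] by blast
  have "U * P = A * V"
    unfolding P_def using assoc_mult_mat[OF mat_adjoint_carrier[OF Uc] A Vc]
      unitary_mat_cancel(2)[OF U mult_carrier_mat[OF A Vc]] by simp
  then have "U * P * mat_adjoint V = A * (V * mat_adjoint V)"
    using assoc_mult_mat[OF A Vc mat_adjoint_carrier[OF Vc]] by simp
  also have "\<dots> = A"
    using V A unfolding unitary_mat_def by simp
  finally show ?thesis
    using U unitary_mat_adjoint[OF V] a B unfolding P by metis
qed

lemma unitarily_symmetrizable_square:
  fixes A :: "complex mat"
  assumes "A \<in> carrier_mat n n"
  shows "unitarily_symmetrizable n A"
  using assms
proof (induction n arbitrary: A)
  case 0
  have "unitary_mat 0 (1\<^sub>m 0)" by (rule unitary_matI) auto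
  moreover have "(1\<^sub>m 0 * A)\<^sup>T = 1\<^sub>m 0 * A" using 0 by (intro eq_matI) auto
  ultimately show ?case unfolding unitarily_symmetrizable_def by blast
next
  case (Suc m)
  obtain U V a B where U: "unitary_mat (Suc m) U" and V: "unitary_mat (Suc m) V"
    and a: "a \<in> carrier_mat 1 1" and B: "B \<in> carrier_mat m m"
    and A: "A = U * four_block_mat a (0\<^sub>m 1 m) (0\<^sub>m m 1) B * V"
    using unitary_block_decomposition[OF Suc.prems] by blast
  have "unitarily_symmetrizable (1 + m) (four_block_mat a (0\<^sub>m 1 m) (0\<^sub>m m 1) B)"
    by (rule unitarily_symmetrizable_four_block_mat[OF a B unitarily_symmetrizable_1[OF a] Suc.IH[OF B]])
  then show ?case
    unfolding A using four_block_carrier_mat[OF a B]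
    by (intro unitarily_symmetrizable_unitary_mult U V) simp_all
qed

section \<open>Pure states\<close>

lemma index_mult_mat_sum:
  assumes "A \<in> carrier_mat n k" "B \<in> carrier_mat k m" "i < n" "j < m"
  shows "(A * B) $$ (i, j) = (\<Sum>l<k. A $$ (i, l) * B $$ (l, j))"
  using assms by (simp add: scalar_prod_def atLeast0LessThan)

definition op_of_mat :: "nat \<Rightarrow> complex mat \<Rightarrow> nat \<Rightarrow> nat \<Rightarrow> complex" where
  "op_of_mat d A = (\<lambda>i j. if i < d \<and> j < d then A $$ (i, j) else 0)"

lemma op_mult_op_of_mat:
  assumes "A \<in> carrier_mat d d" "B \<in> carrier_mat d d"
  shows "op_mult {0..<d} (op_of_mat d A) (op_of_mat d B) = op_of_mat d (A * B)"
proof (intro ext)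
  fix x y
  show "op_mult {0..<d} (op_of_mat d A) (op_of_mat d B) x y = op_of_mat d (A * B) x y"
    using index_mult_mat_sum[OF assms, of x y]
    unfolding op_mult_def op_of_mat_def by (simp add: atLeast0LessThan)
qed

lemma adj_op_of_mat:
  assumes "A \<in> carrier_mat d d"
  shows "adj (op_of_mat d A) = op_of_mat d (mat_adjoint A)"
  unfolding adj_def op_of_mat_def using assms by (auto simp: fun_eq_iff)

lemma op_of_mat_one: "op_of_mat d (1\<^sub>m d) = id_op {0..<d}"
  unfolding op_of_mat_def id_op_def by (auto simp: fun_eq_iff)

lemma unitary_op_of_mat:
  assumes "unitary_mat d U"
  shows "unitary_op {0..<d} (op_of_mat d U)"
  using assms unfolding unitary_op_def unitary_mat_def is_op_def
  by (auto simp: adj_op_of_mat op_mult_op_of_mat op_of_mat_one) (auto simp: op_of_mat_def)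

lemma op_apply_swap_op_of_mat:
  fixes \<phi> :: "nat \<times> nat \<Rightarrow> complex"
  assumes U: "U \<in> carrier_mat d d" and xy: "x < d" "y < d"
  defines "\<Phi> \<equiv> mat d d (\<lambda>(a, b). \<phi> (a, b))"
  shows "op_apply (AB d) (swap_op d (op_of_mat d U)) \<phi> (x, y) = (mat_adjoint U * (U * \<Phi>)\<^sup>T) $$ (x, y)"
proof -
  have \<Phi>: "\<Phi> \<in> carrier_mat d d" unfolding \<Phi>_def by simp
  have "op_apply (AB d) (swap_op d (op_of_mat d U)) \<phi> (x, y)
      = (\<Sum>a<d. \<Sum>b<d. cnj (U $$ (b, x)) * U $$ (y, a) * \<phi> (a, b))"
    unfolding op_apply_def swap_op_def AB_def op_of_mat_def using xy
    by (auto simp: sum.cartesian_product atLeast0LessThan case_prod_unfold intro!: sum.cong)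
  also have "\<dots> = (\<Sum>b<d. mat_adjoint U $$ (x, b) * (\<Sum>a<d. U $$ (y, a) * \<Phi> $$ (a, b)))"
    using xy U unfolding \<Phi>_def
    by (subst sum.swap) (simp add: sum_distrib_left algebra_simps)
  also have "\<dots> = (\<Sum>b<d. mat_adjoint U $$ (x, b) * (U * \<Phi>)\<^sup>T $$ (b, y))"
    using index_mult_mat_sum[OF U \<Phi>, of y] xy U \<Phi> by simp
  also have "\<dots> = (mat_adjoint U * (U * \<Phi>)\<^sup>T) $$ (x, y)"
    using index_mult_mat_sum[OF mat_adjoint_carrier[OF U], of "(U * \<Phi>)\<^sup>T" d x y] xy U \<Phi> by simp
  finally show ?thesis .
qed

lemma swap_fixes_pure_state:
  assumes \<phi>: "is_vec (AB d) \<phi>"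
  shows "\<exists>W. unitary_op {0..<d} W \<and> op_apply (AB d) (swap_op d W) \<phi> = \<phi>"
proof -
  define \<Phi> where "\<Phi> = mat d d (\<lambda>(a, b). \<phi> (a, b))"
  have \<Phi>: "\<Phi> \<in> carrier_mat d d" unfolding \<Phi>_def by simp
  obtain U where U: "unitary_mat d U" and sym: "(U * \<Phi>)\<^sup>T = U * \<Phi>"
    using unitarily_symmetrizable_square[OF \<Phi>] unfolding unitarily_symmetrizable_def by blast
  have "op_apply (AB d) (swap_op d (op_of_mat d U)) \<phi> (x, y) = \<phi> (x, y)" for x y
  proof (cases "x < d \<and> y < d")
    case True
    then show ?thesis
      using op_apply_swap_op_of_mat[OF unitary_mat_carrier[OF U], of x y \<phi>]
        unitary_mat_cancel(1)[OF U \<Phi>] sym unfolding \<Phi>_def[symmetric] by (simp add: \<Phi>_def)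
  next
    case False
    then show ?thesis
      using \<phi> unfolding op_apply_def swap_op_def is_vec_def AB_def by auto
  qed
  then show ?thesis
    using unitary_op_of_mat[OF U] by (intro exI[of _ "op_of_mat d U"]) auto
qed

lemma supported_on_outer_fixed:
  assumes "op_apply C T \<phi> = \<phi>"
  shows "supported_on C (outer \<phi>) (\<lambda>v. op_apply C T v = v)"
  unfolding supported_on_def
proof (intro allI impI)
  fix v
  have "op_apply C (outer \<phi>) v = (\<lambda>x. (\<Sum>y\<in>C. cnj (\<phi> y) * v y) * \<phi> x)"
    unfolding op_apply_outer by (simp add: mult.commute)
  then show "op_apply C T (op_apply C (outer \<phi>) v) = op_apply C (outer \<phi>) v"
    by (simp only: op_apply_scale assms)
qed

lemma uncommon_info_eq_0_if_supported_on_eigenspace: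
  assumes pur: "purification d dR \<rho> \<psi>"
    and sup: "supported_on (AB d) \<rho> (\<lambda>v. op_apply (AB d) (swap_op d W) v = (\<lambda>x. s * v x))"
    and s: "cmod s = 1"
  shows "uncommon_info d dR W \<psi> = 0"
  using uncommon_info_eq_0_if_swap_phase[OF _ swapped_pure_eigen[OF pur sup] s] pur
  unfolding purification_def by simp

theorem mainTheorem3:
  shows "(\<forall>(d :: nat) (dR :: nat) (W :: nat \<Rightarrow> nat \<Rightarrow> complex) \<rho> \<psi>.
            0 < d \<longrightarrow> unitary_op {0..<d} W \<longrightarrow> density_op (AB d) \<rho> \<longrightarrow>
            (supported_on (AB d) \<rho> (symmetric_sub d W) \<or> supported_on (AB d) \<rho> (antisymmetric_sub d W)) \<longrightarrow>
            purification d dR \<rho> \<psi> \<longrightarrow>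
            uncommon_info d dR W \<psi> = 0)
       \<and> (\<forall>(d :: nat) (\<phi> :: nat \<times> nat \<Rightarrow> complex).
            0 < d \<longrightarrow> unit_vec (AB d) \<phi> \<longrightarrow>
            (\<exists>W. unitary_op {0..<d} W \<and>
               (\<forall>(dR :: nat) \<psi>. purification d dR (outer \<phi>) \<psi> \<longrightarrow> uncommon_info d dR W \<psi> = 0)))"
proof (intro conjI allI impI)
  fix d dR :: nat and W :: "nat \<Rightarrow> nat \<Rightarrow> complex" and \<rho> \<psi>
  assume sup: "supported_on (AB d) \<rho> (symmetric_sub d W) \<or> supported_on (AB d) \<rho> (antisymmetric_sub d W)"
    and pur: "purification d dR \<rho> \<psi>"
  show "uncommon_info d dR W \<psi> = 0"
  proof (cases "supported_on (AB d) \<rho> (symmetric_sub d W)")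
    case True
    then show ?thesis
      using uncommon_info_eq_0_if_supported_on_eigenspace[OF pur, of W 1] unfolding symmetric_sub_def by simp
  next
    case False
    then show ?thesis
      using sup uncommon_info_eq_0_if_supported_on_eigenspace[OF pur, of W "-1"]
      unfolding antisymmetric_sub_def by simp
  qed
next
  fix d :: nat and \<phi> :: "nat \<times> nat \<Rightarrow> complex"
  assume "unit_vec (AB d) \<phi>"
  then obtain W where W: "unitary_op {0..<d} W" and W_fixes: "op_apply (AB d) (swap_op d W) \<phi> = \<phi>"
    using swap_fixes_pure_state unfolding Defs.unit_vec_def by blast
  have "supported_on (AB d) (outer \<phi>) (\<lambda>v. op_apply (AB d) (swap_op d W) v = (\<lambda>x. 1 * v x))"
    using supported_on_outer_fixed[OF W_fixes] by simp
  then show "\<exists>W. unitary_op {0..<d} W \<and>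
      (\<forall>dR \<psi>. purification d dR (outer \<phi>) \<psi> \<longrightarrow> uncommon_info d dR W \<psi> = 0)"
    using W uncommon_info_eq_0_if_supported_on_eigenspace[of _ _ "outer \<phi>" _ W 1] by auto
qed

end
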